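(* Let $A\in M_n(\mathbb{C})$. Then $\mathrm{Sol}_A$ is a group if and only if $\ker(A)\cap\ker(A^t)=\{0\}$.
   Context: For $A\in M_n(\mathbb{C})$, $\mathrm{Sol}_A=\{X\in M_n(\mathbb{C}) : X^tAX=A\}$, a monoid under matrix multiplication; "$\mathrm{Sol}_A$ is a group" means every element of $\mathrm{Sol}_A$ is an invertible matrix, i.e. $\mathrm{Sol}_A=\mathrm{Sol}_A\cap GL_n(\mathbb{C})$. Here $^t$ denotes the (non-conjugate) transpose and $\ker(A)=\{v\in\mathbb{C}^n: Av=0\}$. *)

theory Defs
  imports "HOL-Analysis.Analysis"
begin

definition Sol :: "complex^'n^'n \<Rightarrow> (complex^'n^'n) set" where
  "Sol A = {X. transpose X ** A ** X = A}"

definition GL :: "(complex^'n^'n) set" where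
  "GL = {X. invertible X}"

text \<open>
  \<^term>\<open>Sol A\<close> is always a monoid under matrix multiplication with unit \<^term>\<open>mat 1\<close>.
  It being a group means that all its elements are invertible matrices.
  (The inverse of an invertible element of \<^term>\<open>Sol A\<close> lies again in \<^term>\<open>Sol A\<close>.)
\<close>

definition Sol_is_group :: "complex^'n^'n \<Rightarrow> bool" where
  "Sol_is_group A \<longleftrightarrow> Sol A = Sol A \<inter> GL"

definition ker :: "complex^'n^'n \<Rightarrow> (complex^'n) set" where
  "ker A = {v. A *v v = 0}"

end

theory Submission
  imports Defs
begin

text \<open>
  If \<open>X\<^sup>t A X = A\<close>, then the kernel of \<open>X\<close> is contained in both \<open>ker A\<close> and \<open>ker A\<^sup>t\<close>.
  Conversely, the projection \<open>X = 1 - v w\<^sup>t\<close> (with \<open>w\<^sup>t v = 1\<close>) along a nonzero common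
  kernel vector \<open>v\<close> satisfies \<open>A X = A = X\<^sup>t A\<close>, hence is a singular element of \<open>Sol A\<close>.
\<close>

text \<open>Transposing the defining equation puts \<open>X\<close> in
  \<open>Sol (transpose A)\<close> as well. So both \<open>A\<close> and \<open>transpose A\<close>
  have the form \<open>C ** X\<close>, and such a product kills whatever \<open>X\<close>
  kills.\<close>

lemma ker_subset_of_Sol:
  fixes A X :: "complex^'n^'n"
  assumes "X \<in> Sol A"
  shows "ker X \<subseteq> ker A \<inter> ker (transpose A)"
proof
  fix v assume "v \<in> ker X"
  then have v: "X *v v = 0" by (simp add: ker_def)
  have eq: "transpose X ** A ** X = A" using assms by (simp add: Sol_def)
  have "transpose X ** transpose A ** X = transpose (transpose X ** A ** X)"
    by (simp add: matrix_transpose_mul matrix_mul_assoc)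
  with eq have eq': "transpose X ** transpose A ** X = transpose A" by simp
  have kernel: "(C ** X) *v v = 0" for C :: "complex^'n^'n"
    using v by (simp flip: matrix_vector_mul_assoc)
  have "A *v v = 0" using kernel [of "transpose X ** A"] by (simp add: eq)
  moreover have "transpose A *v v = 0"
    using kernel [of "transpose X ** transpose A"] by (simp add: eq')
  ultimately show "v \<in> ker A \<inter> ker (transpose A)" by (simp add: ker_def)
qed

lemma invertible_iff_ker:
  fixes X :: "complex^'n^'n"
  shows "invertible X \<longleftrightarrow> ker X = {0}"
proof -
  have "ker X = {0} \<longleftrightarrow> (\<forall>v. X *v v = 0 \<longrightarrow> v = 0)"
    by (auto simp: ker_def)
  then show ?thesis
    by (simp add: invertible_left_inverse matrix_left_invertible_ker)
qed

text \<open>\<open>X\<close> changes a vector only by a multiple of \<open>v\<close>, which any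
  \<open>B\<close> with \<open>v\<close> in its kernel cannot see. The quantifier over
  \<open>B\<close> lies inside the existential because one \<open>X\<close> must serve both
  \<open>A\<close> and \<open>transpose A\<close>.\<close>

lemma projection_along_vector:
  fixes v :: "'a::field^'n"
  assumes "v \<noteq> 0"
  shows "\<exists>X :: 'a^'n^'n. X *v v = 0 \<and> (\<forall>B :: 'a^'n^'n. B *v v = 0 \<longrightarrow> B ** X = B)"
proof -
  obtain k where k: "v $ k \<noteq> 0" using assms by (auto simp: vec_eq_iff)
  define X :: "'a^'n^'n" where
    "X = (\<chi> i j. (if i = j then 1 else 0) - (if j = k then v $ i / v $ k else 0))"
  have X: "X *v x = x - (x $ k / v $ k) *s v" for x
  proof -
    \<comment> \<open>With the product split this way, each of the two sums over \<open>j\<close>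
      collapses to a single term.\<close>
    have "X $ i $ j * x $ j =
        (if i = j then x $ j else 0) - (if j = k then x $ j / v $ k * v $ i else 0)" for i j
      by (simp add: X_def algebra_simps)
    then show ?thesis
      by (simp add: vec_eq_iff matrix_vector_mult_def sum_subtractf)
  qed
  show ?thesis
  proof (intro exI conjI allI impI)
    show "X *v v = 0" using k by (simp add: X)
    show "B ** X = B" if "B *v v = 0" for B :: "'a^'n^'n"
    proof -
      have "B *v (X *v x) = B *v x" for x
        using that by (simp add: X matrix_vector_mult_diff_distrib vector_scalar_commute)
      then show ?thesis by (simp add: matrix_eq matrix_vector_mul_assoc)
    qed
  qed
qed

theorem theorem3p3:
  fixes A :: "complex^'n^'n"
  shows "Sol_is_group A \<longleftrightarrow> ker A \<inter> ker (transpose A) = {0}"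
proof
  assume group: "Sol_is_group A"
  have "v = 0" if "v \<in> ker A \<inter> ker (transpose A)" for v
  proof (rule ccontr)
    assume "v \<noteq> 0"
    then obtain X :: "complex^'n^'n" where Xv: "X *v v = 0"
      and X: "\<And>B :: complex^'n^'n. B *v v = 0 \<Longrightarrow> B ** X = B"
      using projection_along_vector by blast
    have AX: "A ** X = A" and "transpose A ** X = transpose A"
      using that by (simp_all add: X ker_def)
    \<comment> \<open>Transposing moves \<open>X\<close> to the left of \<open>A\<close>, so
      \<open>transpose X\<close> can be absorbed first and then \<open>X\<close> by
      \<open>AX\<close>.\<close>
    then have "transpose (transpose A ** X) = A" by simp
    then have "transpose X ** A = A" by (simp add: matrix_transpose_mul)
    with AX have "X \<in> Sol A" by (simp add: Sol_def)
    then have "X \<in> GL" using group unfolding Sol_is_group_def by blast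
    then have "ker X = {0}" by (simp add: GL_def invertible_iff_ker)
    with Xv \<open>v \<noteq> 0\<close> show False by (auto simp: ker_def)
  qed
  moreover have "0 \<in> ker A \<inter> ker (transpose A)" by (simp add: ker_def)
  ultimately show "ker A \<inter> ker (transpose A) = {0}" by blast
next
  assume trivial: "ker A \<inter> ker (transpose A) = {0}"
  have "ker X = {0}" if "X \<in> Sol A" for X
  proof -
    have "ker X \<subseteq> {0}" using ker_subset_of_Sol [OF that] trivial by simp
    moreover have "0 \<in> ker X" by (simp add: ker_def)
    ultimately show ?thesis by blast
  qed
  then have "Sol A \<subseteq> GL" by (simp add: subset_iff GL_def invertible_iff_ker)
  then show "Sol_is_group A" unfolding Sol_is_group_def by blast
qed

end
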